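(* Let $A:V\to V$ be a linear operator on the normed vector space $V$ over $\mathbb C$, and let $\sigma(A)$ be a subset of pairwise different eigenvalues of $A$, with corresponding fixed eigenfunctions $v_\lambda$, $\lambda\in\sigma(A)$. Let $\Phi=\varphi(A)$ be an iteration operator of $A$. Assume that $\{F_k\}_{k=0}^{M-1}$ is an admissible set of sampling functionals for $A$. Then each $f=\sum_{j=1}^M c_jv_{\lambda_j}\in\mathcal M(A)$, with $c_j\in\mathbb C\setminus\{0\}$ and pairwise distinct $\lambda_j\in\sigma(A)$, can be completely recovered from the complex samples $F_k(\varphi(A)^\ell f)$, $k=0,\dots,M-1$, $\ell=0,\dots,M$; that is, within the set of all such $M$-term expansions, these samples uniquely determine the set $\{\lambda_1,\dots,\lambda_M\}$ and the corresponding coefficients $c_j$, and hence $f$.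
   Context: For each $\lambda\in\sigma(A)$ one fixed eigenfunction $v_\lambda\in V$ is chosen, with $Av_\lambda=\lambda v_\lambda$, $\|v_\lambda\|_V=1$, such that $\lambda\mapsto v_\lambda$ is injective on $\sigma(A)\ne\emptyset$. $\mathcal M(A)$ is the set of all finite expansions $\sum_j c_jv_{\lambda_j}$ with nonzero complex coefficients and pairwise distinct $\lambda_j\in\sigma(A)$ (together with $0$ it is the linear span of the $v_\lambda$). Iteration operator: given an injective function $\varphi:\sigma(A)\to\mathbb C$, an operator $\Phi=\Phi_\varphi$, also written $\varphi(A)$, is an iteration operator to $A$ if $\Phi:\mathcal M(A)\to\mathcal M(A)$ is a well-defined linear operator and $\Phi v_\lambda=\varphi(\lambda)v_\lambda$ for all $\lambda\in\sigma(A)$. Admissible set of sampling functionals: linear functionals $F_k:V\to\mathbb C$, $k=0,\dots,M-1$, form an admissible set of sampling functionals for $A$ if for all finite subsets $\Lambda_M\subset\sigma(A)$ of cardinality $M<\infty$ the matrix $\left(F_k(v_\lambda)\right)_{k=0,\lambda\in\Lambda_M}^{M-1}$ has full rank $M$. *)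

theory Defs
  imports Complex_Main "Jordan_Normal_Form.DL_Rank"
begin

text \<open>The distribution has only real normed spaces; a complex normed space is a real one whose
  scalar multiplication is extended to the complex numbers, with the norm absolutely homogeneous
  over them.\<close>

class complex_normed_vector = real_normed_vector +
  fixes scaleC :: "complex \<Rightarrow> 'a \<Rightarrow> 'a"  (infixr \<open>*\<^sub>C\<close> 75)
  assumes scaleC_add_right: "a *\<^sub>C (x + y) = a *\<^sub>C x + a *\<^sub>C y"
    and scaleC_add_left: "(a + b) *\<^sub>C x = a *\<^sub>C x + b *\<^sub>C x"
    and scaleC_scaleC: "a *\<^sub>C b *\<^sub>C x = (a * b) *\<^sub>C x"
    and scaleC_one: "1 *\<^sub>C x = x"
    and scaleR_scaleC: "r *\<^sub>R x = complex_of_real r *\<^sub>C x"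
    and norm_scaleC: "norm (a *\<^sub>C x) = cmod a * norm x"

interpretation complex_vector: vector_space "scaleC :: complex \<Rightarrow> 'v \<Rightarrow> 'v::complex_normed_vector"
  by unfold_locales
    (simp_all add: scaleC_add_right scaleC_add_left scaleC_scaleC scaleC_one)

definition eigen_system ::
  "('v::complex_normed_vector \<Rightarrow> 'v) \<Rightarrow> complex set \<Rightarrow> (complex \<Rightarrow> 'v) \<Rightarrow> bool" where
  "eigen_system A \<sigma> v \<longleftrightarrow> \<sigma> \<noteq> {} \<and> inj_on v \<sigma> \<and>
     (\<forall>z\<in>\<sigma>. A (v z) = z *\<^sub>C v z \<and> norm (v z) = 1)"

text \<open>The set of finite expansions. The empty expansion is admitted, so that zero belongs to it:
  otherwise it would not be closed under addition, nor would it be preserved by an iteration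
  operator for which one of the values of \<open>\<phi>\<close> is zero.\<close>

definition expansions :: "complex set \<Rightarrow> (complex \<Rightarrow> 'v::complex_normed_vector) \<Rightarrow> 'v set" where
  "expansions \<sigma> v =
     {(\<Sum>z\<in>\<Lambda>. c z *\<^sub>C v z) | \<Lambda> c. finite \<Lambda> \<and> \<Lambda> \<subseteq> \<sigma> \<and> (\<forall>z\<in>\<Lambda>. c z \<noteq> 0)}"

lemma expansions_eq_span:
  assumes "inj_on v \<sigma>"
  shows "expansions \<sigma> v = complex_vector.span (v ` \<sigma>)"
proof
  show "expansions \<sigma> v \<subseteq> complex_vector.span (v ` \<sigma>)"
  proof
    fix x assume "x \<in> expansions \<sigma> v"
    then obtain L c where x: "x = (\<Sum>z\<in>L. c z *\<^sub>C v z)" and L: "L \<subseteq> \<sigma>"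
      unfolding expansions_def by blast
    have "c z *\<^sub>C v z \<in> complex_vector.span (v ` \<sigma>)" if "z \<in> L" for z
      using that L by (intro complex_vector.span_scale complex_vector.span_base) auto
    then show "x \<in> complex_vector.span (v ` \<sigma>)"
      unfolding x by (rule complex_vector.span_sum)
  qed
next
  show "complex_vector.span (v ` \<sigma>) \<subseteq> expansions \<sigma> v"
  proof
    fix x assume "x \<in> complex_vector.span (v ` \<sigma>)"
    then obtain T r where T: "finite T" "T \<subseteq> v ` \<sigma>" and x: "x = (\<Sum>a\<in>T. r a *\<^sub>C a)"
      by (auto simp: complex_vector.span_explicit)
    obtain L where L: "L \<subseteq> \<sigma>" "T = v ` L" using T(2) by (rule subset_imageE)
    have inj: "inj_on v L" using assms L(1) by (rule inj_on_subset)
    have fin: "finite L" using T(1) finite_image_iff[OF inj] L(2) by simp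
    let ?L = "{z\<in>L. r (v z) \<noteq> 0}"
    have "x = (\<Sum>z\<in>L. r (v z) *\<^sub>C v z)"
      unfolding x L(2) by (subst sum.reindex[OF inj]) simp
    also have "\<dots> = (\<Sum>z\<in>?L. r (v z) *\<^sub>C v z)"
      using fin by (intro sum.mono_neutral_right) auto
    finally have "x = (\<Sum>z\<in>?L. r (v z) *\<^sub>C v z)" .
    moreover have "finite ?L" "?L \<subseteq> \<sigma>" "\<forall>z\<in>?L. r (v z) \<noteq> 0" using fin L(1) by auto
    ultimately show "x \<in> expansions \<sigma> v"
      unfolding expansions_def
      by (intro CollectI exI[of _ ?L] exI[of _ "\<lambda>z. r (v z)"] conjI)
  qed
qed

text \<open>An iteration operator is defined and linear on \<open>expansions \<sigma> v\<close>; nothing is required of the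
  total function \<open>\<Phi>\<close> elsewhere.\<close>

definition iteration_operator ::
  "complex set \<Rightarrow> (complex \<Rightarrow> 'v::complex_normed_vector) \<Rightarrow> (complex \<Rightarrow> complex) \<Rightarrow> ('v \<Rightarrow> 'v) \<Rightarrow> bool"
  where
  "iteration_operator \<sigma> v \<phi> \<Phi> \<longleftrightarrow> inj_on \<phi> \<sigma> \<and>
     (\<forall>f\<in>expansions \<sigma> v. \<Phi> f \<in> expansions \<sigma> v) \<and>
     (\<forall>f\<in>expansions \<sigma> v. \<forall>g\<in>expansions \<sigma> v. \<Phi> (f + g) = \<Phi> f + \<Phi> g) \<and>
     (\<forall>a. \<forall>f\<in>expansions \<sigma> v. \<Phi> (a *\<^sub>C f) = a *\<^sub>C \<Phi> f) \<and>
     (\<forall>z\<in>\<sigma>. \<Phi> (v z) = \<phi> z *\<^sub>C v z)"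

text \<open>The columns of the sampling matrix are indexed by a finite set \<open>\<Lambda>\<close> of eigenvalues; \<open>e\<close> is an
  enumeration of it. The rank does not depend on the choice of \<open>e\<close>.\<close>

definition admissible_sampling ::
  "complex set \<Rightarrow> (complex \<Rightarrow> 'v::complex_normed_vector) \<Rightarrow> nat \<Rightarrow> (nat \<Rightarrow> 'v \<Rightarrow> complex) \<Rightarrow> bool"
  where
  "admissible_sampling \<sigma> v M F \<longleftrightarrow>
     (\<forall>k<M. Vector_Spaces.linear scaleC (*) (F k)) \<and>
     (\<forall>\<Lambda> e. finite \<Lambda> \<and> \<Lambda> \<subseteq> \<sigma> \<and> card \<Lambda> = M \<and> bij_betw e {..<M} \<Lambda> \<longrightarrow>
        vec_space.rank M (mat M M (\<lambda>(k, j). F k (v (e j)))) = M)"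

end

theory Submission
  imports Defs
begin

text \<open>Writing \<open>w j\<close> for \<open>\<phi> (lam j)\<close>, every sample is an exponential sum
  \<open>F k ((\<Phi> ^^ l) f) = (\<Sum>j. c j * w j ^ l * F k (v (lam j)))\<close>
  (\<open>sample_of_iterate\<close>), so the combination of the samples \<open>l = 0, \<dots>, M\<close> with the coefficients of
  a polynomial \<open>p\<close> of degree at most \<open>M\<close> weights the \<open>j\<close>-th term by \<open>poly p (w j)\<close>; it samples
  \<open>p(\<Phi>) f\<close>. This is the idea of Prony's method.

  Let \<open>p\<close> be the Prony polynomial of the second expansion \<open>g\<close>, the monic polynomial of degree \<open>M\<close>
  with the roots \<open>\<phi> (mu i)\<close>. It annihilates \<open>g\<close>, so by equality of the samples
  \<open>p(\<Phi>) f = (\<Sum>j. c j * poly p (w j) *\<^sub>C v (lam j))\<close> is invisible to all \<open>M\<close> functionals.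
  Admissibility says that the functionals separate combinations of \<open>M\<close> eigenvectors
  (\<open>admissible_sampling_separates\<close>), hence \<open>c j * poly p (w j) = 0\<close> for each \<open>j\<close>. As
  \<open>c j\<close> is nonzero, \<open>\<phi> (lam j)\<close> is a root of \<open>p\<close>, and injectivity of \<open>\<phi>\<close> makes \<open>lam j\<close> one of the
  \<open>mu i\<close>. Both sets of eigenvalues have \<open>M\<close> elements, so they coincide. Over this common set the
  samples with \<open>l = 0\<close> already determine the coefficients, again by separation.\<close>

text \<open>The square sampling matrix of full rank has nonzero determinant, hence trivial kernel.\<close>

lemma admissible_sampling_separates:
  assumes adm: "admissible_sampling \<sigma> v M F"
    and lam: "lam ` {1..M} \<subseteq> \<sigma>" "inj_on lam {1..M}"
    and zero: "\<And>k. k < M \<Longrightarrow> (\<Sum>j=1..M. a j * F k (v (lam j))) = 0"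
    and j: "j \<in> {1..M}"
  shows "a j = 0"
proof -
  define e where "e = (\<lambda>i. lam (Suc i))"
  define B where "B = mat M M (\<lambda>(k, i). F k (v (e i)))"
  define x where "x = vec M (\<lambda>i. a (Suc i))"
  have bij: "bij_betw e {..<M} (lam ` {1..M})"
  proof -
    have "bij_betw Suc {..<M} {1..M}"
      by (simp add: bij_betw_def lessThan_atLeast0 atLeastLessThanSuc_atLeastAtMost)
    moreover have "bij_betw lam {1..M} (lam ` {1..M})"
      using lam(2) by (rule inj_on_imp_bij_betw)
    ultimately have "bij_betw (lam \<circ> Suc) {..<M} (lam ` {1..M})"
      by (rule bij_betw_trans)
    then show ?thesis by (simp add: e_def comp_def)
  qed
  have "card (lam ` {1..M}) = M"
    using card_image[OF lam(2)] by simp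
  then have "vec_space.rank M B = M"
    using adm bij lam(1) unfolding admissible_sampling_def B_def by blast
  then have det: "det B \<noteq> 0"
    using vec_space.det_rank_iff[of B M] by (simp add: B_def)
  have "B *\<^sub>v x = 0\<^sub>v M"
  proof (rule eq_vecI)
    fix k assume "k < dim_vec (0\<^sub>v M :: complex vec)"
    then have k: "k < M" by simp
    then have "(B *\<^sub>v x) $ k = (\<Sum>i=0..<M. a (Suc i) * F k (v (lam (Suc i))))"
      by (simp add: B_def x_def e_def scalar_prod_def mult.commute)
    also have "\<dots> = (\<Sum>j=1..M. a j * F k (v (lam j)))"
      using sum.atLeast1_atMost_eq[of "\<lambda>j. a j * F k (v (lam j))" M]
      by (simp add: lessThan_atLeast0)
    finally show "(B *\<^sub>v x) $ k = 0\<^sub>v M $ k" using zero k by simp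
  qed (simp add: B_def)
  moreover have "B \<in> carrier_mat M M" "x \<in> carrier_vec M"
    by (simp_all add: B_def x_def)
  ultimately have "x = 0\<^sub>v M"
    using det by (metis det_0_iff_vec_prod_zero)
  then have "x $ (j - 1) = 0" using j by auto
  then show ?thesis using j by (auto simp: x_def)
qed

lemma eigenvector_sum_in_expansions:
  assumes "inj_on v \<sigma>" and "\<forall>j\<in>J. lam j \<in> \<sigma>"
  shows "(\<Sum>j\<in>J. a j *\<^sub>C v (lam j)) \<in> expansions \<sigma> v"
  unfolding expansions_eq_span[OF assms(1)] using assms(2)
  by (intro complex_vector.span_sum complex_vector.span_scale complex_vector.span_base) auto

lemma iteration_operator_sum:
  assumes inj: "inj_on v \<sigma>" and op: "iteration_operator \<sigma> v \<phi> \<Phi>"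
    and "finite J" and "\<forall>j\<in>J. lam j \<in> \<sigma>"
  shows "\<Phi> (\<Sum>j\<in>J. a j *\<^sub>C v (lam j)) = (\<Sum>j\<in>J. (a j * \<phi> (lam j)) *\<^sub>C v (lam j))"
  using assms(3,4)
proof (induction J)
  case empty
  have "0 \<in> expansions \<sigma> v"
    using eigenvector_sum_in_expansions[OF inj, of "{}"] by simp
  then have "\<Phi> (0 *\<^sub>C 0) = 0 *\<^sub>C \<Phi> 0"
    using op unfolding iteration_operator_def by blast
  then show ?case by simp
next
  case (insert i J)
  have base: "v (lam i) \<in> expansions \<sigma> v" "a i *\<^sub>C v (lam i) \<in> expansions \<sigma> v"
    using insert.prems unfolding expansions_eq_span[OF inj]
    by (auto intro: complex_vector.span_scale complex_vector.span_base)
  have "(\<Sum>j\<in>J. a j *\<^sub>C v (lam j)) \<in> expansions \<sigma> v"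
    using insert.prems by (intro eigenvector_sum_in_expansions[OF inj]) auto
  with base have "\<Phi> (\<Sum>j\<in>insert i J. a j *\<^sub>C v (lam j))
      = a i *\<^sub>C \<Phi> (v (lam i)) + \<Phi> (\<Sum>j\<in>J. a j *\<^sub>C v (lam j))"
    using op insert.hyps unfolding iteration_operator_def by simp
  also have "\<Phi> (v (lam i)) = \<phi> (lam i) *\<^sub>C v (lam i)"
    using op insert.prems unfolding iteration_operator_def by simp
  finally show ?case
    using insert by (simp add: scaleC_scaleC)
qed

lemma iteration_operator_funpow_sum:
  assumes "inj_on v \<sigma>" and "iteration_operator \<sigma> v \<phi> \<Phi>"
    and "finite J" and "\<forall>j\<in>J. lam j \<in> \<sigma>"
  shows "(\<Phi> ^^ l) (\<Sum>j\<in>J. a j *\<^sub>C v (lam j)) = (\<Sum>j\<in>J. (a j * \<phi> (lam j) ^ l) *\<^sub>C v (lam j))"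
proof (induction l)
  case (Suc l)
  then show ?case
    using iteration_operator_sum[OF assms, of "\<lambda>j. a j * \<phi> (lam j) ^ l"]
    by (simp add: mult_ac)
qed simp

lemma sample_of_iterate:
  assumes "inj_on v \<sigma>" and "iteration_operator \<sigma> v \<phi> \<Phi>"
    and "admissible_sampling \<sigma> v M F" and "k < M"
    and "finite J" and "\<forall>j\<in>J. lam j \<in> \<sigma>"
  shows "F k ((\<Phi> ^^ l) (\<Sum>j\<in>J. a j *\<^sub>C v (lam j)))
    = (\<Sum>j\<in>J. a j * \<phi> (lam j) ^ l * F k (v (lam j)))"
proof -
  interpret Fk: Vector_Spaces.linear scaleC "(*)" "F k"
    using assms(3,4) unfolding admissible_sampling_def by blast
  show ?thesis
    by (simp add: iteration_operator_funpow_sum[OF assms(1,2,5,6)] Fk.sum Fk.scale)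
qed

text \<open>Interchanging the two summations turns the powers of \<open>\<phi> (lam j)\<close> into a value of \<open>p\<close>; the
  bound on the degree is what limits the number of iterates that have to be sampled.\<close>

lemma polynomial_combination_of_samples:
  fixes p :: "complex poly"
  assumes "inj_on v \<sigma>" and "iteration_operator \<sigma> v \<phi> \<Phi>"
    and "admissible_sampling \<sigma> v M F" and "k < M"
    and "finite J" and "\<forall>j\<in>J. lam j \<in> \<sigma>" and deg: "degree p \<le> N"
  shows "(\<Sum>l\<le>N. coeff p l * F k ((\<Phi> ^^ l) (\<Sum>j\<in>J. a j *\<^sub>C v (lam j))))
    = (\<Sum>j\<in>J. a j * poly p (\<phi> (lam j)) * F k (v (lam j)))"
proof -
  have "(\<Sum>l\<le>N. coeff p l * F k ((\<Phi> ^^ l) (\<Sum>j\<in>J. a j *\<^sub>C v (lam j))))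
      = (\<Sum>j\<in>J. \<Sum>l\<le>N. a j * (coeff p l * \<phi> (lam j) ^ l) * F k (v (lam j)))"
    unfolding sample_of_iterate[OF assms(1-6)] sum_distrib_left
    by (subst sum.swap) (simp add: mult_ac)
  also have "\<dots> = (\<Sum>j\<in>J. a j * poly p (\<phi> (lam j)) * F k (v (lam j)))"
  proof -
    have "poly p x = (\<Sum>l\<le>N. coeff p l * x ^ l)" for x
      unfolding poly_altdef using deg
      by (intro sum.mono_neutral_left) (auto simp: coeff_eq_0)
    then show ?thesis by (simp add: sum_distrib_left sum_distrib_right)
  qed
  finally show ?thesis .
qed

theorem theorem3p10:
  fixes A \<Phi> :: "'v::complex_normed_vector \<Rightarrow> 'v"
    and \<sigma> :: "complex set"
    and v :: "complex \<Rightarrow> 'v"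
    and \<phi> :: "complex \<Rightarrow> complex"
    and M :: nat
    and F :: "nat \<Rightarrow> 'v \<Rightarrow> complex"
    and c d lam mu :: "nat \<Rightarrow> complex"
    and f g :: 'v
  assumes "Vector_Spaces.linear scaleC scaleC A"
    and "eigen_system A \<sigma> v"
    and "iteration_operator \<sigma> v \<phi> \<Phi>"
    and "admissible_sampling \<sigma> v M F"
    and "f = (\<Sum>j=1..M. c j *\<^sub>C v (lam j))"
    and "\<forall>j\<in>{1..M}. c j \<noteq> 0 \<and> lam j \<in> \<sigma>"
    and "inj_on lam {1..M}"
    and "g = (\<Sum>j=1..M. d j *\<^sub>C v (mu j))"
    and "\<forall>j\<in>{1..M}. d j \<noteq> 0 \<and> mu j \<in> \<sigma>"
    and "inj_on mu {1..M}"
    and "\<forall>k<M. \<forall>l\<le>M. F k ((\<Phi> ^^ l) f) = F k ((\<Phi> ^^ l) g)"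
  shows "lam ` {1..M} = mu ` {1..M} \<and>
         (\<forall>i\<in>{1..M}. \<forall>j\<in>{1..M}. lam i = mu j \<longrightarrow> c i = d j) \<and>
         f = g"
proof -
  let ?J = "{1..M}"
  note f = assms(5) and g = assms(8)
  have inj: "inj_on v \<sigma>" using assms(2) by (simp add: eigen_system_def)
  have lam: "\<forall>j\<in>?J. lam j \<in> \<sigma>" "lam ` ?J \<subseteq> \<sigma>" using assms(6) by auto
  have mu: "\<forall>j\<in>?J. mu j \<in> \<sigma>" using assms(9) by auto
  define p where "p = (\<Prod>i\<in>?J. [:- \<phi> (mu i), 1:])"
  have deg: "degree p \<le> M"
    unfolding p_def by (rule order.trans[OF degree_prod_sum_le]) auto
  have root: "poly p z = 0 \<longleftrightarrow> z \<in> (\<lambda>i. \<phi> (mu i)) ` ?J" for z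
    by (auto simp: p_def poly_prod)
  have annihilated: "c j * poly p (\<phi> (lam j)) = 0" if "j \<in> ?J" for j
  proof (rule admissible_sampling_separates[OF assms(4) lam(2) assms(7) _ that])
    fix k assume k: "k < M"
    have "(\<Sum>j\<in>?J. c j * poly p (\<phi> (lam j)) * F k (v (lam j)))
        = (\<Sum>l\<le>M. coeff p l * F k ((\<Phi> ^^ l) f))"
      unfolding f
      by (rule polynomial_combination_of_samples[symmetric, OF inj assms(3,4) k _ lam(1) deg]) simp
    also have "\<dots> = (\<Sum>l\<le>M. coeff p l * F k ((\<Phi> ^^ l) g))"
      using assms(11) k by simp
    also have "\<dots> = (\<Sum>j\<in>?J. d j * poly p (\<phi> (mu j)) * F k (v (mu j)))"
      unfolding g by (rule polynomial_combination_of_samples[OF inj assms(3,4) k _ mu deg]) simp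
    also have "\<dots> = 0"
      by (intro sum.neutral ballI) (use root in auto)
    finally show "(\<Sum>j\<in>?J. c j * poly p (\<phi> (lam j)) * F k (v (lam j))) = 0" .
  qed
  have "lam ` ?J \<subseteq> mu ` ?J"
  proof
    fix z assume "z \<in> lam ` ?J"
    then obtain j where j: "j \<in> ?J" and z: "z = lam j" by blast
    have "poly p (\<phi> (lam j)) = 0" using annihilated[OF j] assms(6) j by simp
    then obtain i where "i \<in> ?J" "\<phi> (lam j) = \<phi> (mu i)" unfolding root by blast
    moreover have "inj_on \<phi> \<sigma>" using assms(3) by (simp add: iteration_operator_def)
    ultimately have "lam j = mu i" using lam(1) mu j by (auto dest: inj_onD)
    then show "z \<in> mu ` ?J" using z \<open>i \<in> ?J\<close> by blast
  qed
  then have sets: "lam ` ?J = mu ` ?J"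
    by (intro card_subset_eq) (simp_all only: card_image assms(7,10) finite_imageI finite_atLeastAtMost)
  \<comment> \<open>The two enumerations of the common set may differ; \<open>s\<close> translates between them.\<close>
  define s where "s = (\<lambda>j. the_inv_into ?J mu (lam j))"
  have s: "s j \<in> ?J" "mu (s j) = lam j" if "j \<in> ?J" for j
  proof -
    have "lam j \<in> mu ` ?J" using that sets by blast
    then show "s j \<in> ?J" "mu (s j) = lam j"
      unfolding s_def
      by (simp_all only: the_inv_into_into[OF assms(10) _ subset_refl]
          f_the_inv_into_f[OF assms(10)])
  qed
  have s_bij: "bij_betw s ?J ?J"
  proof -
    have "inj_on s ?J"
      by (rule inj_onI) (metis s(2) inj_onD[OF assms(7)])
    moreover have "s ` ?J \<subseteq> ?J" using s(1) by blast
    ultimately show ?thesis by (simp add: bij_betw_def endo_inj_surj)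
  qed
  have g_lam: "g = (\<Sum>j\<in>?J. d (s j) *\<^sub>C v (lam j))"
    unfolding g using s(2)
    by (subst sum.reindex_bij_betw[OF s_bij, symmetric]) (rule sum.cong, simp_all)
  have coeff_eq: "c j = d (s j)" if "j \<in> ?J" for j
  proof -
    have "c j - d (s j) = 0"
    proof (rule admissible_sampling_separates[OF assms(4) lam(2) assms(7) _ that])
      fix k assume k: "k < M"
      have "F k ((\<Phi> ^^ 0) f) = F k ((\<Phi> ^^ 0) g)" using assms(11) k by blast
      then show "(\<Sum>j\<in>?J. (c j - d (s j)) * F k (v (lam j))) = 0"
        unfolding f g_lam
        using sample_of_iterate[OF inj assms(3,4) k _ lam(1), where l = 0]
        by (simp add: left_diff_distrib sum_subtractf)
    qed
    then show ?thesis by simp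
  qed
  have "c i = d j" if "i \<in> ?J" "j \<in> ?J" "lam i = mu j" for i j
  proof -
    have "s i = j"
      using s[OF that(1)] that by (intro inj_onD[OF assms(10)]) simp_all
    then show ?thesis using coeff_eq[OF that(1)] by simp
  qed
  moreover have "f = g"
    unfolding f g_lam by (rule sum.cong) (simp_all add: coeff_eq)
  ultimately show ?thesis using sets by blast
qed

end
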